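(* Let $E(q)=(q;q)_\infty$, $R(q)=\frac{(q,q^4;q^5)_\infty}{(q^2,q^3;q^5)_\infty}$ and $k(q)=qR(q)R(q^2)^2$. Then, as formal Laurent series in $q$, $$\frac{k(q)}{k(q^2)}-\frac{k(q^2)}{k(q)}=\frac{E(q)E(q^5)^3}{qE(q^{10})^4}.$$
   Context: $(A;q)_\infty=\prod_{k\ge0}(1-Aq^k)$, $(A_1,\dots,A_n;q)_\infty=\prod_i(A_i;q)_\infty$. *)

theory Defs
  imports "HOL-Analysis.Infinite_Products" "HOL-Computational_Algebra.Formal_Laurent_Series"
begin

text \<open>
  The argument \<open>q\<close> ranges over formal Laurent series, so that \<open>k(q\<^sup>2)\<close> is literally the function
  \<open>k\<close> applied to \<open>q\<^sup>2\<close>; the formal variable itself is \<^const>\<open>fls_X\<close>.  The infinite product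
  \<^const>\<open>prodinf\<close> is taken in the \<open>X\<close>-adic topology, which is the one given by the
  \<^class>\<open>metric_space\<close> instance of \<open>fls\<close>.  For \<open>A = fls_X ^ a\<close> and \<open>q = fls_X ^ b\<close> with
  \<open>a, b > 0\<close> the product converges to a nonzero series.
\<close>

definition qpoch :: "'a::field fls \<Rightarrow> 'a fls \<Rightarrow> 'a fls" where
  "qpoch A q = (\<Prod>k. 1 - A * q ^ k)"

definition qpochs :: "'a::field fls list \<Rightarrow> 'a fls \<Rightarrow> 'a fls" where
  "qpochs As q = (\<Prod>A\<leftarrow>As. qpoch A q)"

definition Efun :: "'a::field fls \<Rightarrow> 'a fls" where
  "Efun q = qpoch q q"

definition Rfun :: "'a::field fls \<Rightarrow> 'a fls" where
  "Rfun q = qpochs [q, q ^ 4] (q ^ 5) / qpochs [q ^ 2, q ^ 3] (q ^ 5)"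

definition kfun :: "'a::field fls \<Rightarrow> 'a fls" where
  "kfun q = q * Rfun q * Rfun (q ^ 2) ^ 2"

end

theory Submission
  imports Defs
begin

text \<open>
  Write \<open>J a b = (q\<^sup>a, q\<^bsup>b-a\<^esup>, q\<^sup>b; q\<^sup>b)\<^sub>\<infinity>\<close>. Then \<open>k(q)/k(q\<^sup>2) = U/V\<close> with \<open>U = J 1 10 (J 8 20)\<^sup>2\<close> and
  \<open>V = q J 3 10 (J 4 20)\<^sup>2\<close>, so with \<open>W = J 4 20 J 8 20\<close> it suffices to factor \<open>U\<^sup>2 - V\<^sup>2\<close> by
  \<open>U + V = J 5 10 W\<close> and \<open>U - V = J 1 2 W\<close>. The first is an instance of Weierstrass's three-term
  relation, which the Jacobi triple product turns into a Pluecker relation between 2-by-2 determinants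
  of theta series. Given the first, the second follows, up to a sign visible in the constant term,
  from \<open>(J 5 10)\<^sup>2 - (J 1 2)\<^sup>2 = 4q J 1 10 J 3 10\<close>, that is, from splitting the sums of two squares
  by residue classes of Gaussian integers modulo \<open>1 + 2i\<close>.
\<close>

section \<open>Infinite products\<close>

text \<open>\<open>(X^a; X^b)_inf\<close> as a power series. Coefficient \<open>n\<close> can be
  read off the product of the first \<open>n\<close> factors: for \<open>a, b > 0\<close> every
  later factor has its exponent above \<open>n\<close>.\<close>

definition fps_qpoch :: "nat \<Rightarrow> nat \<Rightarrow> 'a::field fps" where
  "fps_qpoch a b = Abs_fps (\<lambda>n. (\<Prod>k<n. 1 - fps_X ^ (a + b * k)) $ n)"

lemma fps_nth_prod_one_minus_X_power:
  assumes "a > 0" "b > 0" "n \<le> M"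
  shows "(\<Prod>k<M. 1 - fps_X ^ (a + b * k)) $ n = (fps_qpoch a b :: 'a::field fps) $ n"
  using assms(3)
proof (induction M rule: dec_induct)
  case base
  then show ?case by (simp add: fps_qpoch_def)
next
  case (step M)
  have "n < a + b * M"
  proof -
    have "M \<le> b * M" using assms(2) by simp
    then show ?thesis using step(1) assms(1) by linarith
  qed
  then have "((\<Prod>k<M. 1 - fps_X ^ (a + b * k)) * fps_X ^ (a + b * M) :: 'a fps) $ n = 0"
    by (subst fps_X_power_mult_right_nth) auto
  with step.IH show ?case by (simp add: algebra_simps)
qed

lemma fps_qpoch_nth_0 [simp]: "fps_qpoch a b $ 0 = 1"
  by (simp add: fps_qpoch_def)

lemma fps_qpoch_nonzero [simp]: "fps_qpoch a b \<noteq> 0"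
  using fps_qpoch_nth_0[of a b] by (metis fps_zero_nth zero_neq_one)

lemma tendsto_fps_qpoch:
  assumes "a > 0" "b > 0"
  shows "(\<lambda>M. \<Prod>k<M. 1 - fps_X ^ (a + b * k)) \<longlonglongrightarrow> (fps_qpoch a b :: 'a::field fps)"
proof (rule tendsto_fpsI)
  fix n
  show "eventually (\<lambda>M. (\<Prod>k<M. 1 - fps_X ^ (a + b * k)) $ n = (fps_qpoch a b :: 'a fps) $ n) sequentially"
    using eventually_ge_at_top[of n]
    by eventually_elim (simp add: fps_nth_prod_one_minus_X_power assms)
qed

text \<open>The embedding preserves the order of vanishing, hence the metric, so limits of power
  series carry over to Laurent series.\<close>

lemma dist_fps_to_fls [simp]: "dist (fps_to_fls f) (fps_to_fls g) = dist f g"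
proof (cases "f = g")
  case False
  have "fps_to_fls f - fps_to_fls g = fps_to_fls (f - g)"
    by (rule fls_eqI) simp
  then have "fls_subdegree (fps_to_fls f - fps_to_fls g) = int (subdegree (f - g))"
    by (simp only: fls_subdegree_fls_to_fps)
  with False show ?thesis
    by (simp add: dist_fls_def dist_fps_def)
qed simp

lemma fps_to_fls_prod: "fps_to_fls (prod f A) = (\<Prod>x\<in>A. fps_to_fls (f x :: 'a::comm_ring_1 fps))"
  by (induction A rule: infinite_finite_induct) (simp_all add: fls_times_fps_to_fls)

text \<open>The bridge from the infinite products of the statement to power series, where all
  identities below are proved.\<close>

lemma qpoch_fls_X_power:
  assumes "a > 0" "b > 0"
  shows "qpoch (fls_X ^ a) (fls_X ^ b) = fps_to_fls (fps_qpoch a b :: 'a::field fps)"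
proof -
  have *: "1 - fls_X ^ a * (fls_X ^ b) ^ k = fps_to_fls (1 - fps_X ^ (a + b * k) :: 'a fps)" for k
    by (simp add: fps_to_fls_power power_add power_mult fls_times_fps_to_fls)
  have "(\<lambda>M. fps_to_fls (\<Prod>k<M. 1 - fps_X ^ (a + b * k))) \<longlonglongrightarrow> fps_to_fls (fps_qpoch a b :: 'a fps)"
    by (subst tendsto_dist_iff)
      (simp add: tendsto_dist_iff[THEN iffD1, OF tendsto_fps_qpoch[OF assms]])
  then have "(\<lambda>M. \<Prod>k\<le>M. 1 - fls_X ^ a * (fls_X ^ b) ^ k) \<longlonglongrightarrow> fps_to_fls (fps_qpoch a b :: 'a fps)"
    unfolding * fps_to_fls_prod by (simp add: LIMSEQ_lessThan_iff_atMost)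
  \<comment> \<open>\<open>raw_has_prod\<close> asks for a nonzero limit; \<open>fps_qpoch\<close>
    has constant term 1.\<close>
  then have "(\<lambda>k. 1 - fls_X ^ a * (fls_X ^ b) ^ k) has_prod fps_to_fls (fps_qpoch a b :: 'a fps)"
    by (simp add: has_prod_def raw_has_prod_def)
  then show ?thesis
    unfolding qpoch_def by (rule has_prod_unique [symmetric])
qed

section \<open>Dissection of q-products by residue classes\<close>

lemma prod_lessThan_mult:
  fixes f :: "nat \<Rightarrow> 'b::comm_monoid_mult"
  shows "(\<Prod>k<m * n. f k) = (\<Prod>r<m. \<Prod>j<n. f (r + m * j))"
proof -
  have "(\<Prod>k<m * n. f k) = (\<Prod>j<n. \<Prod>k = j * m..<j * m + m. f k)"
    by (simp add: prod.nat_group mult.commute)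
  also have "\<dots> = (\<Prod>j<n. \<Prod>r<m. f (r + m * j))"
  proof (rule prod.cong[OF refl])
    fix j
    show "(\<Prod>k = j * m..<j * m + m. f k) = (\<Prod>r<m. f (r + m * j))"
      by (rule prod.reindex_bij_witness[of _ "\<lambda>r. r + m * j" "\<lambda>k. k - m * j"]) (auto simp: mult.commute)
  qed
  also have "\<dots> = (\<Prod>r<m. \<Prod>j<n. f (r + m * j))"
    by (rule prod.swap)
  finally show ?thesis .
qed

text \<open>Congruence modulo \<open>X^(N+1)\<close>. Identities between infinite products are
  checked on finite truncations, one \<open>N\<close> at a time.\<close>

definition fps_agree :: "nat \<Rightarrow> 'a::comm_ring_1 fps \<Rightarrow> 'a fps \<Rightarrow> bool" where
  "fps_agree N f g \<longleftrightarrow> (\<forall>i\<le>N. f $ i = g $ i)"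

lemma fps_agree_refl [simp]: "fps_agree N f f"
  by (simp add: fps_agree_def)

lemma fps_agree_sym: "fps_agree N f g \<Longrightarrow> fps_agree N g f"
  by (simp add: fps_agree_def)

lemma fps_agree_trans [trans]: "fps_agree N f g \<Longrightarrow> fps_agree N g h \<Longrightarrow> fps_agree N f h"
  by (simp add: fps_agree_def)

lemma fps_agree_mult: "fps_agree N f f' \<Longrightarrow> fps_agree N g g' \<Longrightarrow> fps_agree N (f * g) (f' * g')"
  by (auto simp: fps_agree_def fps_mult_nth intro!: sum.cong)

lemma fps_agree_prod: "(\<And>x. x \<in> A \<Longrightarrow> fps_agree N (f x) (g x)) \<Longrightarrow> fps_agree N (prod f A) (prod g A)"
  by (induction A rule: infinite_finite_induct) (auto intro: fps_agree_mult)

lemma fps_agree_qpoch: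
  "a > 0 \<Longrightarrow> b > 0 \<Longrightarrow> N \<le> M \<Longrightarrow> fps_agree N (\<Prod>k<M. 1 - fps_X ^ (a + b * k)) (fps_qpoch a b)"
  by (simp add: fps_agree_def fps_nth_prod_one_minus_X_power)

lemma fps_eq_if_agree: "(\<And>N. fps_agree N f g) \<Longrightarrow> f = g"
  by (auto simp: fps_agree_def fps_eq_iff)

text \<open>Sort the factors by their index modulo \<open>m\<close>. A truncation to
  \<open>m * N\<close> factors leaves \<open>N\<close> in each class, enough for agreement up to
  degree \<open>N\<close>.\<close>

lemma fps_qpoch_split:
  assumes "a > 0" "b > 0" "m > 0"
  shows "fps_qpoch a b = (\<Prod>r<m. fps_qpoch (a + b * r) (b * m) :: 'a::field fps)"
proof (rule fps_eq_if_agree)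
  fix N
  have "fps_agree N (fps_qpoch a b :: 'a fps) (\<Prod>k<m * N. 1 - fps_X ^ (a + b * k))"
    using assms by (intro fps_agree_sym[OF fps_agree_qpoch]) auto
  also have "(\<Prod>k<m * N. 1 - fps_X ^ (a + b * k)) =
      (\<Prod>r<m. \<Prod>j<N. 1 - fps_X ^ (a + b * r + b * m * j) :: 'a fps)"
    by (subst prod_lessThan_mult) (simp add: algebra_simps)
  also have "fps_agree N \<dots> (\<Prod>r<m. fps_qpoch (a + b * r) (b * m))"
    using assms by (intro fps_agree_prod fps_agree_qpoch) auto
  finally show "fps_agree N (fps_qpoch a b) (\<Prod>r<m. fps_qpoch (a + b * r) (b * m) :: 'a fps)" .
qed

section \<open>Series indexed by quadratic exponents\<close>

text \<open>The formal series of \<open>c i * X^(e i)\<close>. Integer exponents allow quadratic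
  polynomials to be rearranged without truncated subtraction.\<close>

definition fps_isum :: "'i set \<Rightarrow> ('i \<Rightarrow> 'a) \<Rightarrow> ('i \<Rightarrow> int) \<Rightarrow> 'a::comm_ring_1 fps" where
  "fps_isum I c e = Abs_fps (\<lambda>n. \<Sum>i | i \<in> I \<and> e i = int n. c i)"

text \<open>This excludes negative exponents, and infinite fibres, on which \<^const>\<open>sum\<close> would be \<open>0\<close>.\<close>

definition exponents_ok :: "'i set \<Rightarrow> ('i \<Rightarrow> int) \<Rightarrow> bool" where
  "exponents_ok I e \<longleftrightarrow> (\<forall>i\<in>I. 0 \<le> e i) \<and> (\<forall>n. finite {i \<in> I. e i \<le> int n})"

lemma exponents_ok_finite: "exponents_ok I e \<Longrightarrow> finite {i \<in> I. e i = int n}"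
  unfolding exponents_ok_def by (auto intro: finite_subset[of _ "{i \<in> I. e i \<le> int n}"])

lemma exponents_ok_add_const:
  assumes "exponents_ok I e" "0 \<le> k"
  shows "exponents_ok I (\<lambda>i. e i + k)"
  unfolding exponents_ok_def
proof (intro conjI allI ballI)
  fix n
  have "{i \<in> I. e i + k \<le> int n} \<subseteq> {i \<in> I. e i \<le> int n}"
    using assms(2) by auto
  then show "finite {i \<in> I. e i + k \<le> int n}"
    using assms(1) finite_subset unfolding exponents_ok_def by blast
qed (use assms in \<open>auto simp: exponents_ok_def\<close>)

lemma exponents_ok_Times:
  assumes "exponents_ok I e" "exponents_ok J f"
  shows "exponents_ok (I \<times> J) (\<lambda>(i, j). e i + f j)"
  unfolding exponents_ok_def
proof (intro conjI allI ballI)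
  fix n
  have "{p \<in> I \<times> J. (case p of (i, j) \<Rightarrow> e i + f j) \<le> int n} \<subseteq> {i \<in> I. e i \<le> int n} \<times> {j \<in> J. f j \<le> int n}"
    using assms by (force simp: exponents_ok_def)
  then show "finite {p \<in> I \<times> J. (case p of (i, j) \<Rightarrow> e i + f j) \<le> int n}"
    using assms by (auto simp: exponents_ok_def intro: finite_subset)
qed (use assms in \<open>auto simp: exponents_ok_def\<close>)

text \<open>Cauchy product: pairs with total exponent \<open>n\<close> are grouped by the exponent
  of the first component, which lies between \<open>0\<close> and \<open>n\<close> because no
  exponent is negative.\<close>

lemma fps_isum_mult:
  assumes "exponents_ok I e" "exponents_ok J f"
  shows "fps_isum I c e * fps_isum J d f =
    fps_isum (I \<times> J) (\<lambda>(i, j). c i * d j) (\<lambda>(i, j). e i + f j)"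
proof (rule fps_ext)
  fix n
  let ?S = "{p. p \<in> I \<times> J \<and> (case p of (i, j) \<Rightarrow> e i + f j) = int n}"
  have nn: "\<And>i. i \<in> I \<Longrightarrow> 0 \<le> e i" "\<And>j. j \<in> J \<Longrightarrow> 0 \<le> f j"
    using assms by (auto simp: exponents_ok_def)
  have "(fps_isum I c e * fps_isum J d f) $ n =
      (\<Sum>k=0..n. (\<Sum>i | i \<in> I \<and> e i = int k. c i) * (\<Sum>j | j \<in> J \<and> f j = int (n - k). d j))"
    by (simp add: fps_isum_def fps_mult_nth)
  also have "\<dots> = (\<Sum>k=0..n. \<Sum>p | p \<in> ?S \<and> nat (e (fst p)) = k. (case p of (i, j) \<Rightarrow> c i * d j))"
  proof (rule sum.cong[OF refl])
    fix k assume k: "k \<in> {0..n}"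
    have "{p. p \<in> ?S \<and> nat (e (fst p)) = k} = {i. i \<in> I \<and> e i = int k} \<times> {j. j \<in> J \<and> f j = int (n - k)}"
      using k nn by (auto simp: of_nat_diff)
    then show "(\<Sum>i | i \<in> I \<and> e i = int k. c i) * (\<Sum>j | j \<in> J \<and> f j = int (n - k). d j) =
        (\<Sum>p | p \<in> ?S \<and> nat (e (fst p)) = k. (case p of (i, j) \<Rightarrow> c i * d j))"
      by (simp add: sum_product sum.cartesian_product)
  qed
  also have "\<dots> = (\<Sum>p\<in>?S. (case p of (i, j) \<Rightarrow> c i * d j))"
  proof (rule sum.group)
    show "finite ?S"
      using exponents_ok_finite[OF exponents_ok_Times[OF assms], of n] by simp
    show "(\<lambda>p. nat (e (fst p))) ` ?S \<subseteq> {0..n}"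
      using nn by fastforce
  qed simp
  finally show "(fps_isum I c e * fps_isum J d f) $ n =
      fps_isum (I \<times> J) (\<lambda>(i, j). c i * d j) (\<lambda>(i, j). e i + f j) $ n"
    by (simp add: fps_isum_def)
qed

text \<open>Change of variables with \<open>g\<close> and \<open>h\<close> mutually inverse; the
  lattice substitutions below are instances.\<close>

lemma fps_isum_bij_witness:
  assumes "\<And>i. i \<in> I \<Longrightarrow> g i \<in> J \<and> h (g i) = i \<and> c (g i) = d i \<and> e (g i) = f i"
    and "\<And>j. j \<in> J \<Longrightarrow> h j \<in> I \<and> g (h j) = j"
  shows "fps_isum J c e = fps_isum I d f"
proof (rule fps_ext)
  fix n
  show "fps_isum J c e $ n = fps_isum I d f $ n"
    unfolding fps_isum_def fps_nth_Abs_fps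
    by (rule sum.reindex_bij_witness[of _ g h]) (use assms in force)+
qed

lemma fps_isum_split:
  assumes "exponents_ok I e" "finite R" "\<And>i. i \<in> I \<Longrightarrow> r i \<in> R"
  shows "fps_isum I c e = (\<Sum>s\<in>R. fps_isum {i \<in> I. r i = s} c e)"
proof (rule fps_ext)
  fix n
  have "(\<Sum>s\<in>R. \<Sum>i | i \<in> {i \<in> I. e i = int n} \<and> r i = s. c i) = (\<Sum>i\<in>{i \<in> I. e i = int n}. c i)"
    by (rule sum.group) (use assms exponents_ok_finite in auto)
  then show "fps_isum I c e $ n = (\<Sum>s\<in>R. fps_isum {i \<in> I. r i = s} c e) $ n"
    by (simp add: fps_isum_def fps_sum_nth conj_ac)
qed

lemma fps_X_power_mult_isum:
  assumes "exponents_ok I e"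
  shows "fps_X ^ k * fps_isum I c e = fps_isum I c (\<lambda>i. e i + int k)"
proof (rule fps_ext)
  fix n
  have "{i. i \<in> I \<and> e i + int k = int n} = (if n < k then {} else {i. i \<in> I \<and> e i = int (n - k)})"
    using assms by (auto simp: exponents_ok_def of_nat_diff)
  then show "(fps_X ^ k * fps_isum I c e) $ n = fps_isum I c (\<lambda>i. e i + int k) $ n"
    by (simp add: fps_isum_def fps_X_power_mult_nth)
qed

lemma fps_isum_uminus: "- fps_isum I c e = fps_isum I (\<lambda>i. - c i) e"
  by (rule fps_ext) (simp add: fps_isum_def sum_negf)

text \<open>The linear term is at most \<open>A * |t|\<close> in absolute value, so the value is at
  least \<open>A * (t^2 - |t|) + C\<close>, which is nonnegative for integer \<open>t\<close>.
  Growth in \<open>|t|\<close>, needed for finite fibres, comes from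
  \<open>(|t| - 1)^2 >= 0\<close>.\<close>

lemma quadratic_ge_abs:
  fixes A B C t :: int
  assumes "1 \<le> A" "\<bar>B\<bar> \<le> A" "0 \<le> C"
  shows "\<bar>t\<bar> - 1 \<le> A * t^2 + B * t + C" "0 \<le> A * t^2 + B * t + C"
proof -
  have a: "\<bar>B * t\<bar> \<le> A * \<bar>t\<bar>"
    using assms by (simp add: abs_mult mult_right_mono)
  have s: "t^2 = \<bar>t\<bar> * \<bar>t\<bar>"
    by (simp add: power2_eq_square)
  have "0 \<le> \<bar>t\<bar> * (\<bar>t\<bar> - 1)"
    by (cases "t = 0") auto
  then have p: "0 \<le> t^2 - \<bar>t\<bar>"
    by (simp add: s algebra_simps)
  then have "1 * (t^2 - \<bar>t\<bar>) \<le> A * (t^2 - \<bar>t\<bar>)"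
    using assms by (intro mult_right_mono)
  with a have b: "t^2 - \<bar>t\<bar> \<le> A * t^2 + B * t"
    by (simp add: algebra_simps abs_le_iff)
  with p assms show "0 \<le> A * t^2 + B * t + C" by linarith
  have "0 \<le> (\<bar>t\<bar> - 1)^2" by simp
  then have "\<bar>t\<bar> - 1 \<le> t^2 - \<bar>t\<bar>"
    by (simp add: s power2_eq_square algebra_simps)
  with b assms show "\<bar>t\<bar> - 1 \<le> A * t^2 + B * t + C" by linarith
qed

lemma exponents_ok_quadratic:
  fixes A B C :: int
  assumes "1 \<le> A" "\<bar>B\<bar> \<le> A" "0 \<le> C"
  shows "exponents_ok UNIV (\<lambda>t. A * t^2 + B * t + C)"
  unfolding exponents_ok_def
proof (intro conjI allI ballI)
  fix n
  have "{i \<in> UNIV. A * i^2 + B * i + C \<le> int n} \<subseteq> {- int n - 1..int n + 1}"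
  proof
    fix i assume "i \<in> {i \<in> UNIV. A * i^2 + B * i + C \<le> int n}"
    then show "i \<in> {- int n - 1..int n + 1}"
      using quadratic_ge_abs(1)[OF assms, of i] by auto
  qed
  then show "finite {i \<in> UNIV. A * i^2 + B * i + C \<le> int n}"
    by (rule finite_subset) simp
qed (use quadratic_ge_abs(2)[OF assms] in auto)

section \<open>The Jacobi triple product\<close>

text \<open>\<open>(-1)^n\<close> for an integer \<open>n\<close>, where \<open>power\<close> would
  ask for a natural exponent.\<close>

definition parity_sign :: "int \<Rightarrow> 'a::comm_ring_1" where
  "parity_sign n = (if even n then 1 else - 1)"

lemma parity_sign_minus [simp]: "parity_sign (- n) = parity_sign n"
  by (simp add: parity_sign_def)

text \<open>\<open>1 / (q; q)\<^sub>K\<close> for \<open>q = X\<^sup>b\<close>; it vanishes for \<open>K < 0\<close> so that its recurrence holds for every integer \<open>K\<close>.\<close>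

definition qfact_inv :: "nat \<Rightarrow> int \<Rightarrow> 'a::field fps" where
  "qfact_inv b K = (if K < 0 then 0 else inverse (\<Prod>k<nat K. 1 - fps_X ^ (b + b * k)))"

lemma qfact_inv_pred:
  assumes "b > 0"
  shows "qfact_inv b (K - 1) = (1 - fps_X ^ nat (int b * K)) * (qfact_inv b K :: 'a::field fps)"
proof (cases "K \<ge> 1")
  case True
  define k where "k = nat (K - 1)"
  have K: "K = int (Suc k)"
    using True by (simp add: k_def)
  then have "int b * K = int (b + b * k)"
    by (simp add: algebra_simps)
  then have bK: "nat (int b * K) = b + b * k"
    by (simp only: nat_int)
  let ?x = "1 - fps_X ^ (b + b * k) :: 'a fps"
  have "?x $ 0 \<noteq> 0" using assms by simp
  then have "?x * inverse ?x = 1"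
    by (metis inverse_mult_eq_1')
  moreover have "qfact_inv b (K - 1) = inverse (\<Prod>k<k. 1 - fps_X ^ (b + b * k) :: 'a fps)"
    "qfact_inv b K = inverse (\<Prod>k<k. 1 - fps_X ^ (b + b * k)) * inverse ?x"
    unfolding K qfact_inv_def by (simp_all add: fps_inverse_mult nat_add_distrib)
  ultimately show ?thesis
    unfolding bK by (simp only: mult.left_commute[of ?x] mult_1_right)
next
  case False
  \<comment> \<open>At \<open>K = 0\<close> the factor \<open>1 - X^0\<close> vanishes, as does the
    left side; for \<open>K < 0\<close> both sides carry the default value 0.\<close>
  then show ?thesis by (cases "K = 0") (auto simp: qfact_inv_def)
qed

section \<open>The finite form of the triple product\<close>

context
  fixes B :: nat
  assumes B: "B > 0"
begin

text \<open>The exponent of \<open>z^j * q^(j * (j - 1) / 2)\<close> at \<open>z = X^a\<close> and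
  \<open>q = X^(2 * B)\<close>; the even base keeps it integral without division.\<close>

abbreviation "theta_exp a j \<equiv> int B * j^2 + (int a - int B) * j"

abbreviation "theta_term a j \<equiv> parity_sign j * fps_X ^ nat (theta_exp a j) :: 'a::field fps"

text \<open>After multiplication by \<open>(q; q)_(m+n)\<close> with \<open>q = X^(2 * B)\<close>,
  the coefficients of the theta terms are the Gaussian binomials
  \<open>[m + n, n + j]\<close>.\<close>

definition jtp_sum :: "nat \<Rightarrow> nat \<Rightarrow> nat \<Rightarrow> 'a::field fps" where
  "jtp_sum a m n = (\<Sum>j=-int n..int m. theta_term a j * (qfact_inv (2*B) (int n + j) * qfact_inv (2*B) (int m - j)))"

lemma theta_exp_nonneg: "a \<le> 2 * B \<Longrightarrow> 0 \<le> theta_exp a j"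
  using quadratic_ge_abs(2)[of "int B" "int a - int B" 0 j] B by auto

text \<open>Consecutive theta exponents differ by \<open>a + 2 * B * (j - 1)\<close>; the extra
  power tops this up to \<open>a + 2 * B * m\<close>, which is independent of
  \<open>j\<close>.\<close>

lemma theta_term_shift:
  assumes "a \<le> 2 * B" "j \<le> int m + 1"
  shows "theta_term a j * fps_X ^ nat (int (2*B) * (int m + 1 - j)) =
    - (fps_X ^ (a + 2*B*m) * (theta_term a (j - 1) :: 'a::field fps))"
proof -
  have "nat (theta_exp a j) + nat (int (2*B) * (int m + 1 - j)) =
      nat (theta_exp a j + int (2*B) * (int m + 1 - j))"
    using theta_exp_nonneg[OF assms(1), of j] assms by (subst nat_add_distrib) auto
  also have "theta_exp a j + int (2*B) * (int m + 1 - j) = int (a + 2*B*m) + theta_exp a (j - 1)"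
    by (simp add: algebra_simps power2_eq_square)
  also have "nat \<dots> = (a + 2*B*m) + nat (theta_exp a (j - 1))"
    using theta_exp_nonneg[OF assms(1), of "j - 1"] by (subst nat_add_distrib) (auto simp del: of_nat_add of_nat_mult)
  finally have "fps_X ^ nat (theta_exp a j) * fps_X ^ nat (int (2*B) * (int m + 1 - j)) =
      (fps_X ^ (a + 2*B*m) * fps_X ^ nat (theta_exp a (j - 1)) :: 'a fps)"
    by (simp only: flip: power_add)
  then show ?thesis
    by (simp add: parity_sign_def)
qed

text \<open>The q-Pascal rule, summed over \<open>j\<close>. With \<open>q = X^(2 * B)\<close>,
  \<open>p = q^(m+1-j)\<close> and \<open>r = q^(n+j)\<close>, write
  \<open>1 - p * r = (1 - p) + p * (1 - r)\<close>. Each part lowers the index of one denominator,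
  and \<open>theta_term_shift\<close> absorbs the leftover \<open>p\<close>, so both parts are
  multiples of the same sum.\<close>

lemma jtp_sum_Suc:
  assumes a: "a \<le> 2 * B"
  shows "(1 - fps_X ^ (2*B*(m + n + 1))) * jtp_sum a (Suc m) n =
    (1 - fps_X ^ (a + 2*B*m)) * (jtp_sum a m n :: 'a::field fps)"
proof -
  let ?c = "qfact_inv (2*B) :: int \<Rightarrow> 'a fps"
  let ?x = "fps_X ^ (a + 2*B*m) :: 'a fps"
  let ?t = "theta_term a :: int \<Rightarrow> 'a fps"
  let ?J = "{-int n..int m + 1}"
  let ?f = "\<lambda>j. ?t j * (?c (int n + j) * ?c (int m - j))"
  have "(1 - fps_X ^ (2*B*(m + n + 1))) * jtp_sum a (Suc m) n =
      (\<Sum>j\<in>?J. ?t j * ((1 - fps_X ^ (2*B*(m + n + 1))) * (?c (int n + j) * ?c (int m + 1 - j))))"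
    unfolding jtp_sum_def by (simp add: sum_distrib_left mult_ac add_ac)
  also have "\<dots> = (\<Sum>j\<in>?J. ?f j - ?x * ?f (j - 1))"
  proof (rule sum.cong[OF refl])
    fix j assume j: "j \<in> ?J"
    let ?p = "fps_X ^ nat (int (2*B) * (int m + 1 - j)) :: 'a fps"
    let ?r = "fps_X ^ nat (int (2*B) * (int n + j)) :: 'a fps"
    have "nat (int (2*B) * (int m + 1 - j)) + nat (int (2*B) * (int n + j)) = nat (int (2*B) * (int m + 1 - j) + int (2*B) * (int n + j))"
      using j by (subst nat_add_distrib) auto
    also have "int (2*B) * (int m + 1 - j) + int (2*B) * (int n + j) = int (2*B*(m + n + 1))"
      by (simp add: algebra_simps)
    finally have pr: "fps_X ^ (2*B*(m + n + 1)) = ?p * ?r"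
      by (simp only: nat_int flip: power_add)
    have c1: "?c (int m - j) = (1 - ?p) * ?c (int m + 1 - j)"
      using qfact_inv_pred[of "2*B" "int m + 1 - j"] B by simp
    have c2: "?c (int n + (j - 1)) = (1 - ?r) * ?c (int n + j)"
      using qfact_inv_pred[of "2*B" "int n + j"] B by (simp add: algebra_simps)
    have c3: "?c (int m - (j - 1)) = ?c (int m + 1 - j)"
      by (simp add: algebra_simps)
    have t: "?x * ?t (j - 1) = - (?t j * ?p)"
      using theta_term_shift[OF a, of j m, where 'a = 'a] j by simp
    have "?f j - ?x * ?f (j - 1) = ?t j * (?c (int n + j) * ((1 - ?p) * ?c (int m + 1 - j)))
        - (?x * ?t (j - 1)) * ((1 - ?r) * ?c (int n + j) * ?c (int m + 1 - j))"
      by (simp only: c1 c2 c3 mult.assoc)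
    also have "\<dots> = ?t j * ((1 - ?p * ?r) * (?c (int n + j) * ?c (int m + 1 - j)))"
      unfolding t by (simp add: algebra_simps)
    finally show "?t j * ((1 - fps_X ^ (2*B*(m + n + 1))) * (?c (int n + j) * ?c (int m + 1 - j)))
        = ?f j - ?x * ?f (j - 1)"
      unfolding pr by simp
  qed
  also have "\<dots> = (\<Sum>j\<in>?J. ?f j) - ?x * (\<Sum>j\<in>?J. ?f (j - 1))"
    by (simp add: sum_subtractf sum_distrib_left)
  \<comment> \<open>The index \<open>j = m + 1\<close> contributes nothing, since
    \<open>qfact_inv\<close> is 0 at \<open>-1\<close>; in the shifted sum
    \<open>j = - n - 1\<close> drops out likewise.\<close>
  also have "(\<Sum>j\<in>?J. ?f j) = jtp_sum a m n"
    unfolding jtp_sum_def by (rule sum.mono_neutral_right) (auto simp: qfact_inv_def)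
  also have "(\<Sum>j\<in>?J. ?f (j - 1)) = (\<Sum>j\<in>{-int n - 1..int m}. ?f j)"
    by (rule sum.reindex_bij_witness[of _ "\<lambda>j. j + 1" "\<lambda>j. j - 1"]) auto
  also have "\<dots> = jtp_sum a m n"
    unfolding jtp_sum_def by (rule sum.mono_neutral_right) (auto simp: qfact_inv_def)
  finally show ?thesis
    by (simp add: algebra_simps)
qed

text \<open>Replacing \<open>j\<close> by \<open>- j\<close> exchanges \<open>a\<close> with
  \<open>2 * B - a\<close> and swaps the two denominators.\<close>

lemma jtp_sum_commute:
  assumes "a \<le> 2 * B"
  shows "jtp_sum (2*B - a) n m = (jtp_sum a m n :: 'a::field fps)"
  unfolding jtp_sum_def
proof (rule sum.reindex_bij_witness[of _ uminus uminus])
  fix j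
  have e: "theta_exp (2*B - a) (- j) = theta_exp a j" for j
    using assms by (simp add: of_nat_diff algebra_simps)
  show "theta_term a (- j) * (qfact_inv (2*B) (int n + - j) * qfact_inv (2*B) (int m - - j)) =
      (theta_term (2*B - a) j * (qfact_inv (2*B) (int m + j) * qfact_inv (2*B) (int n - j)) :: 'a fps)"
    using e[of "- j"] by (simp add: mult_ac)
qed auto

text \<open>The second hypothesis is the case \<open>m = 0\<close>, which the symmetry \<open>a \<leftrightarrow> 2B - a\<close> reduces to \<open>n = 0\<close>.\<close>

lemma finite_jacobi_step:
  assumes "a \<le> 2 * B"
    and "(\<Prod>k<n. 1 - fps_X ^ (2*B - a + 2*B*k)) = (\<Prod>k<n. 1 - fps_X ^ (2*B + 2*B*k)) * (jtp_sum a 0 n :: 'a::field fps)"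
  shows "(\<Prod>k<m. 1 - fps_X ^ (a + 2*B*k)) * (\<Prod>k<n. 1 - fps_X ^ (2*B - a + 2*B*k)) =
    (\<Prod>k<m + n. 1 - fps_X ^ (2*B + 2*B*k)) * (jtp_sum a m n :: 'a::field fps)"
proof (induction m)
  case 0
  then show ?case using assms(2) by simp
next
  case (Suc m)
  have "(\<Prod>k<Suc m + n. 1 - fps_X ^ (2*B + 2*B*k)) * (jtp_sum a (Suc m) n :: 'a fps) =
     (\<Prod>k<m + n. 1 - fps_X ^ (2*B + 2*B*k)) * ((1 - fps_X ^ (2*B*(m + n + 1))) * jtp_sum a (Suc m) n)"
    by (simp add: algebra_simps)
  also have "\<dots> = (1 - fps_X ^ (a + 2*B*m)) * ((\<Prod>k<m + n. 1 - fps_X ^ (2*B + 2*B*k)) * jtp_sum a m n)"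
    unfolding jtp_sum_Suc[OF assms(1)] by (simp add: mult_ac)
  finally show ?case
    unfolding Suc.IH[symmetric] by (simp add: mult_ac)
qed

lemma finite_jacobi_triple_product:
  assumes "a \<le> 2 * B"
  shows "(\<Prod>k<m. 1 - fps_X ^ (a + 2*B*k)) * (\<Prod>k<n. 1 - fps_X ^ (2*B - a + 2*B*k)) =
    (\<Prod>k<m + n. 1 - fps_X ^ (2*B + 2*B*k)) * (jtp_sum a m n :: 'a::field fps)"
proof (rule finite_jacobi_step[OF assms])
  have "jtp_sum (2*B - a) 0 0 = (1 :: 'a fps)"
    by (simp add: jtp_sum_def qfact_inv_def parity_sign_def)
  then have "(\<Prod>k<n. 1 - fps_X ^ (2*B - a + 2*B*k)) =
      (\<Prod>k<n. 1 - fps_X ^ (2*B + 2*B*k)) * (jtp_sum (2*B - a) n 0 :: 'a fps)"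
    using finite_jacobi_step[of "2*B - a" 0 n, where 'a = 'a] by simp
  then show "(\<Prod>k<n. 1 - fps_X ^ (2*B - a + 2*B*k)) =
      (\<Prod>k<n. 1 - fps_X ^ (2*B + 2*B*k)) * (jtp_sum a 0 n :: 'a fps)"
    by (simp add: jtp_sum_commute[OF assms])
qed

end

section \<open>Passage from the finite form to the infinite triple product\<close>

lemma fps_agree_inverse:
  assumes "fps_agree N f g" "fps_nth f 0 \<noteq> 0"
  shows "fps_agree N (inverse f) (inverse g :: 'a::field fps)"
proof -
  have "fps_nth g 0 \<noteq> 0"
    using assms by (auto simp: fps_agree_def)
  then have fg: "inverse f * f = 1" "g * inverse g = 1"
    using assms(2) by (simp_all add: inverse_mult_eq_1 inverse_mult_eq_1')
  have "fps_agree N (inverse f * (f * inverse g)) (inverse f * (g * inverse g))"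
    by (intro fps_agree_mult assms fps_agree_refl)
  then show ?thesis
    by (simp add: fg fps_agree_sym flip: mult.assoc)
qed

lemma fps_agree_sum: "(\<And>x. x \<in> A \<Longrightarrow> fps_agree N (f x) (g x)) \<Longrightarrow> fps_agree N (sum f A) (sum g A)"
  by (auto simp: fps_agree_def fps_sum_nth intro!: sum.cong)

text \<open>The \<open>J a b\<close> of the opening overview.\<close>

definition jprod :: "nat \<Rightarrow> nat \<Rightarrow> 'a::field fps" where
  "jprod a b = fps_qpoch b b * (fps_qpoch a b * fps_qpoch (b - a) b)"

text \<open>The finite form with \<open>m = n\<close>, read modulo \<open>X^(N+1)\<close>: for small
  \<open>|j|\<close> every truncated product is already complete and the normalising factors cancel
  to 1, while for large \<open>|j|\<close> the power of \<open>X\<close> exceeds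
  \<open>N\<close>.\<close>

theorem jacobi_triple_product:
  assumes "0 < a" "a < 2 * B"
  shows "jprod a (2 * B) =
    (fps_isum UNIV parity_sign (\<lambda>j. int B * j^2 + (int a - int B) * j) :: 'a::field fps)"
proof (rule fps_eq_if_agree)
  fix N :: nat
  have B: "B > 0" using assms by simp
  \<comment> \<open>If \<open>|j| <= N + 1\<close>, then \<open>n + j\<close> and
    \<open>n - j\<close> are both at least \<open>N\<close>; otherwise the exponent is at least
    \<open>|j| - 1 > N\<close>.\<close>
  define n where "n = 2 * N + 1"
  let ?Q = "fps_qpoch (2*B) (2*B) :: 'a fps"
  let ?P = "\<lambda>m. \<Prod>k<m. 1 - fps_X ^ (2*B + 2*B*k) :: 'a fps"
  let ?c = "qfact_inv (2*B) :: int \<Rightarrow> 'a fps"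
  let ?e = "\<lambda>j. int B * j^2 + (int a - int B) * j"
  let ?t = "\<lambda>j. parity_sign j * fps_X ^ nat (?e j) :: 'a fps"
  have e: "0 \<le> ?e j" "\<bar>j\<bar> - 1 \<le> ?e j" for j
    using quadratic_ge_abs[of "int B" "int a - int B" 0 j] assms by auto
  have Q: "?Q * inverse ?Q = 1"
    by (simp add: inverse_mult_eq_1')
  have c: "fps_agree N (?c (int M)) (inverse ?Q)" if "N \<le> M" for M
  proof -
    have "fps_agree N (?P M) ?Q"
      using that B by (intro fps_agree_qpoch) auto
    moreover have "?P M $ 0 = 1"
      by (subst fps_nth_prod_one_minus_X_power) (use B in auto)
    ultimately show ?thesis
      unfolding qfact_inv_def using fps_agree_inverse by force
  qed
  have "fps_agree N (jprod a (2*B))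
      (?Q * ((\<Prod>k<n. 1 - fps_X ^ (a + 2*B*k)) * (\<Prod>k<n. 1 - fps_X ^ (2*B - a + 2*B*k))))"
    unfolding jprod_def using assms
    by (intro fps_agree_mult fps_agree_refl fps_agree_sym[OF fps_agree_qpoch]) (auto simp: n_def)
  also have "\<dots> = (\<Sum>j=-int n..int n. ?t j * (?Q * ?P (n + n) * (?c (int n + j) * ?c (int n - j))))"
    using assms finite_jacobi_triple_product[OF B, of a n n, where 'a = 'a]
    by (simp only: less_imp_le jtp_sum_def[OF B] sum_distrib_left mult_ac)
  also have "fps_agree N \<dots> (\<Sum>j=-int n..int n. ?t j * (?Q * ?Q * (inverse ?Q * inverse ?Q)))"
  proof (rule fps_agree_sum)
    fix j assume j: "j \<in> {-int n..int n}"
    show "fps_agree N (?t j * (?Q * ?P (n + n) * (?c (int n + j) * ?c (int n - j))))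
        (?t j * (?Q * ?Q * (inverse ?Q * inverse ?Q)))"
    proof (cases "\<bar>j\<bar> \<le> int N + 1")
      case True
      have "int n + j = int (nat (int n + j))" "int n - j = int (nat (int n - j))"
        using j by auto
      then have "fps_agree N (?c (int n + j)) (inverse ?Q)" "fps_agree N (?c (int n - j)) (inverse ?Q)"
        using c[of "nat (int n + j)"] c[of "nat (int n - j)"] True by (auto simp: n_def)
      moreover have "fps_agree N (?P (n + n)) ?Q"
        using B by (intro fps_agree_qpoch) (auto simp: n_def)
      ultimately show ?thesis
        by (intro fps_agree_mult fps_agree_refl)
    next
      case False
      then have "N < nat (?e j)"
        using e[of j] by linarith
      then have "fps_agree N (?t j * f) (?t j * g)" for f g
        by (auto simp: parity_sign_def fps_agree_def fps_X_power_mult_nth mult.assoc)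
      then show ?thesis .
    qed
  qed
  also have "?Q * ?Q * (inverse ?Q * inverse ?Q) = 1"
    using Q by (simp add: mult.assoc mult.left_commute[of ?Q "inverse ?Q"])
  also have "fps_agree N (\<Sum>j=-int n..int n. ?t j * 1) (fps_isum UNIV parity_sign ?e)"
    unfolding fps_agree_def
  proof (intro allI impI)
    fix i assume i: "i \<le> N"
    have "?t j $ i = (if ?e j = int i then parity_sign j else 0)" for j
      using e(1)[of j] by (auto simp: parity_sign_def)
    then have "(\<Sum>j=-int n..int n. ?t j * 1) $ i = (\<Sum>j=-int n..int n. if ?e j = int i then parity_sign j else 0)"
      by (simp add: fps_sum_nth)
    also have "\<dots> = (\<Sum>j\<in>{j \<in> {-int n..int n}. ?e j = int i}. parity_sign j)"
      by (simp only: sum.inter_filter finite_atLeastAtMost_int)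
    also have "{j \<in> {-int n..int n}. ?e j = int i} = {j. ?e j = int i}"
    proof -
      have "j \<in> {-int n..int n}" if "?e j = int i" for j
        using e(2)[of j] that i by (auto simp: n_def)
      then show ?thesis by auto
    qed
    finally show "(\<Sum>j=-int n..int n. ?t j * 1) $ i = fps_isum UNIV parity_sign ?e $ i"
      by (simp add: fps_isum_def)
  qed
  finally show "fps_agree N (jprod a (2*B)) (fps_isum UNIV parity_sign ?e :: 'a fps)" .
qed

section \<open>Theta function identities\<close>

lemma parity_sign_add: "parity_sign (m + n) = parity_sign m * parity_sign n"
  by (simp add: parity_sign_def)

lemma jprod_nth_0 [simp]: "fps_nth (jprod a b) 0 = 1"
  by (simp add: jprod_def)

lemma jprod_nonzero [simp]: "jprod a b \<noteq> 0"
  by (simp add: jprod_def)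

lemma jprod_reflect: "a \<le> b \<Longrightarrow> jprod (b - a) b = jprod a b"
  by (simp add: jprod_def mult_ac)

section \<open>Products of theta series as sums over the integer plane\<close>

definition theta_plain :: "int \<Rightarrow> int \<Rightarrow> int \<Rightarrow> 'a::comm_ring_1 fps" where
  "theta_plain A B C = fps_isum UNIV (\<lambda>_. 1) (\<lambda>t. A * t^2 + B * t + C)"

lemma theta_plain_mult:
  assumes "1 \<le> A" "\<bar>B\<bar> \<le> A" "0 \<le> C" "\<bar>B'\<bar> \<le> A" "0 \<le> C'"
  shows "theta_plain A B C * theta_plain A B' C' =
    (fps_isum UNIV (\<lambda>_. 1) (\<lambda>(t, r). A * t^2 + B * t + C + (A * r^2 + B' * r + C')) :: 'a::comm_ring_1 fps)"
  unfolding theta_plain_def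
  using assms by (subst fps_isum_mult) (auto intro!: exponents_ok_quadratic arg_cong2[of _ _ _ _ "fps_isum UNIV"])

text \<open>Two triple products with a common base become one signed double sum, open to linear
  substitutions of the index pair.\<close>

lemma jprod_mult:
  assumes "0 < a" "a < 2 * A" "0 < b" "b < 2 * A"
  shows "jprod a (2 * A) * jprod b (2 * A) =
    (fps_isum UNIV (\<lambda>(m, n). parity_sign (m + n))
      (\<lambda>(m, n). int A * (m^2 + n^2) + (int a - int A) * m + (int b - int A) * n) :: 'a::field fps)"
    and "exponents_ok UNIV (\<lambda>(m, n). int A * (m^2 + n^2) + (int a - int A) * m + (int b - int A) * n)"
proof -
  let ?e = "\<lambda>a j. int A * j^2 + (int a - int A) * j"
  have ok: "exponents_ok UNIV (?e a)" if "0 < a" "a < 2 * A" for a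
    using exponents_ok_quadratic[of "int A" "int a - int A" 0] that by auto
  have e: "(\<lambda>(i, j). ?e a i + ?e b j) =
      (\<lambda>(m, n). int A * (m^2 + n^2) + (int a - int A) * m + (int b - int A) * n)"
    by (auto simp: algebra_simps)
  show "exponents_ok UNIV (\<lambda>(m, n). int A * (m^2 + n^2) + (int a - int A) * m + (int b - int A) * n)"
    using exponents_ok_Times[OF ok[of a] ok[of b]] assms by (simp add: e)
  have "jprod a (2 * A) * jprod b (2 * A) =
      (fps_isum (UNIV \<times> UNIV) (\<lambda>(i, j). parity_sign i * parity_sign j) (\<lambda>(i, j). ?e a i + ?e b j) :: 'a fps)"
    using assms by (simp only: jacobi_triple_product fps_isum_mult ok)
  then show "jprod a (2 * A) * jprod b (2 * A) =
    (fps_isum UNIV (\<lambda>(m, n). parity_sign (m + n))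
      (\<lambda>(m, n). int A * (m^2 + n^2) + (int a - int A) * m + (int b - int A) * n) :: 'a fps)"
    by (simp add: e parity_sign_add)
qed

text \<open>
  Substituting \<open>m + n\<close> and \<open>m - n\<close> for the summation indices separates the variables, so the
  product becomes a 2-by-2 determinant of a vector depending on \<open>a + b\<close> and one depending on
  \<open>a - b\<close>. The shifts \<open>C, C', D, D'\<close> only clear the denominators in \<open>X\<close>.
\<close>

lemma theta_determinant:
  fixes A a b k :: nat and C C' D D' :: int
  defines "u \<equiv> int a + int b" and "v \<equiv> int a - int b"
  assumes ab: "0 < a" "a < 2 * A" "0 < b" "b < 2 * A"
    and bounds: "\<bar>u\<bar> \<le> 2 * int A" "\<bar>v\<bar> \<le> 2 * int A" "\<bar>u - 2 * int A\<bar> \<le> 2 * int A" "\<bar>v - 2 * int A\<bar> \<le> 2 * int A"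
    and nonneg: "0 \<le> C" "0 \<le> C'" "0 \<le> D" "0 \<le> D'"
    and shifts: "D + C' = int k" "C + D' = int k + int b"
  shows "fps_X ^ k * (jprod a (2 * A) * jprod b (2 * A)) =
    (theta_plain (2 * int A) (u - 2 * int A) D * theta_plain (2 * int A) v C' -
     theta_plain (2 * int A) u C * theta_plain (2 * int A) (v - 2 * int A) D' :: 'a::field fps)"
proof -
  have A: "1 \<le> 2 * int A" using ab by simp
  let ?e = "\<lambda>(m, n). int A * (m^2 + n^2) + (int a - int A) * m + (int b - int A) * n"
  let ?e' = "\<lambda>p. ?e p + int k"
  let ?s = "(\<lambda>(m, n). parity_sign (m + n)) :: int \<times> int \<Rightarrow> 'a"
  have ok: "exponents_ok UNIV ?e" using jprod_mult(2)[OF ab] .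
  then have ok': "exponents_ok UNIV ?e'"
    by (rule exponents_ok_add_const) simp
  have "fps_X ^ k * (jprod a (2 * A) * jprod b (2 * A)) = fps_isum UNIV ?s ?e'"
    unfolding jprod_mult(1)[OF ab] by (rule fps_X_power_mult_isum[OF ok])
  \<comment> \<open>\<open>(t + r, t - r)\<close> reaches only the pairs with even sum. The odd
    pairs carry the sign -1, need a substitution of their own and give the second term of the
    determinant.\<close>
  also have "\<dots> = (\<Sum>s\<in>{True, False}. fps_isum {p \<in> UNIV. even (fst p + snd p) = s} ?s ?e')"
    by (rule fps_isum_split[OF ok']) auto
  also have "\<dots> = fps_isum {p. even (fst p + snd p)} ?s ?e' - fps_isum {p. odd (fst p + snd p)} (\<lambda>p. - ?s p) ?e'"
    by (simp flip: fps_isum_uminus)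
  also have "fps_isum {p. even (fst p + snd p)} ?s ?e' =
      theta_plain (2 * int A) (u - 2 * int A) D * theta_plain (2 * int A) v C'"
    unfolding theta_plain_mult[OF A bounds(3) nonneg(3) bounds(2) nonneg(2)]
  proof (rule fps_isum_bij_witness[where g = "\<lambda>(t, r). (t + r, t - r)" and h = "\<lambda>(m, n). ((m + n) div 2, (m - n) div 2)"])
    fix i :: "int \<times> int"
    obtain t r where i: "i = (t, r)" by fastforce
    show "(case i of (t, r) \<Rightarrow> (t + r, t - r)) \<in> {p. even (fst p + snd p)} \<and>
      (case case i of (t, r) \<Rightarrow> (t + r, t - r) of (m, n) \<Rightarrow> ((m + n) div 2, (m - n) div 2)) = i \<and>
      ?s (case i of (t, r) \<Rightarrow> (t + r, t - r)) = 1 \<and>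
      ?e' (case i of (t, r) \<Rightarrow> (t + r, t - r)) =
      (case i of (t, r) \<Rightarrow> 2 * int A * t\<^sup>2 + (u - 2 * int A) * t + D + (2 * int A * r\<^sup>2 + v * r + C'))"
      using shifts(1) by (auto simp: i parity_sign_def u_def v_def power2_eq_square algebra_simps)
  next
    fix j :: "int \<times> int"
    assume "j \<in> {p. even (fst p + snd p)}"
    then show "(case j of (m, n) \<Rightarrow> ((m + n) div 2, (m - n) div 2)) \<in> UNIV \<and>
      (case case j of (m, n) \<Rightarrow> ((m + n) div 2, (m - n) div 2) of (t, r) \<Rightarrow> (t + r, t - r)) = j"
      by (cases j) (simp, presburger)
  qed
  also have "fps_isum {p. odd (fst p + snd p)} (\<lambda>p. - ?s p) ?e' =
      theta_plain (2 * int A) u C * theta_plain (2 * int A) (v - 2 * int A) D'"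
    unfolding theta_plain_mult[OF A bounds(1) nonneg(1) bounds(4) nonneg(4)]
  \<comment> \<open>On this coset the form acquires the constant term \<open>b\<close>, which
    explains the shift condition \<open>C + D' = int k + int b\<close>.\<close>
  proof (rule fps_isum_bij_witness[where g = "\<lambda>(t, r). (t + r, t + 1 - r)" and h = "\<lambda>(m, n). ((m + n - 1) div 2, (m - n + 1) div 2)"])
    fix i :: "int \<times> int"
    obtain t r where i: "i = (t, r)" by fastforce
    have "t + r - (t + 1 - r) + 1 = 2 * r" "t + r + (t + 1 - r) = 2 * t + 1" by simp_all
    then show "(case i of (t, r) \<Rightarrow> (t + r, t + 1 - r)) \<in> {p. odd (fst p + snd p)} \<and>
      (case case i of (t, r) \<Rightarrow> (t + r, t + 1 - r) of (m, n) \<Rightarrow> ((m + n - 1) div 2, (m - n + 1) div 2)) = i \<and>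
      - ?s (case i of (t, r) \<Rightarrow> (t + r, t + 1 - r)) = 1 \<and>
      ?e' (case i of (t, r) \<Rightarrow> (t + r, t + 1 - r)) =
      (case i of (t, r) \<Rightarrow> 2 * int A * t\<^sup>2 + u * t + C + (2 * int A * r\<^sup>2 + (v - 2 * int A) * r + D'))"
      using shifts(2) by (auto simp: i parity_sign_def u_def v_def power2_eq_square algebra_simps)
  next
    fix j :: "int \<times> int"
    assume "j \<in> {p. odd (fst p + snd p)}"
    then show "(case j of (m, n) \<Rightarrow> ((m + n - 1) div 2, (m - n + 1) div 2)) \<in> UNIV \<and>
      (case case j of (m, n) \<Rightarrow> ((m + n - 1) div 2, (m - n + 1) div 2) of (t, r) \<Rightarrow> (t + r, t + 1 - r)) = j"
      by (cases j) (simp, presburger)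
  qed
  finally show ?thesis .
qed

text \<open>The Pluecker relation for the determinants of the four vectors with parameters 1, 7, 9, 17.\<close>

lemma jprod_base_20:
  "jprod 1 20 * jprod 9 20 * jprod 8 20 ^ 2 + fps_X * jprod 3 20 * jprod 7 20 * jprod 4 20 ^ 2 =
    (jprod 5 20 ^ 2 * jprod 4 20 * jprod 8 20 :: 'a::field fps)"
proof -
  let ?\<alpha> = "theta_plain 20 :: int \<Rightarrow> int \<Rightarrow> 'a fps"
  \<comment> \<open>The arguments supplied below are \<open>a, b, C, C', D, D', k\<close>.
    Parameters \<open>u > v\<close> have \<open>a = (u + v) / 2\<close> and
    \<open>b = (u - v) / 2\<close>; each parameter keeps its pair of shifts throughout, so the six
    determinants are built from the same four vectors.\<close>
  note det = theta_determinant[of _ 10, simplified, where 'a = 'a]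
  have 1: "fps_X * (jprod 8 20 * jprod 1 20) = ?\<alpha> (-11) 1 * ?\<alpha> 7 0 - ?\<alpha> 9 0 * ?\<alpha> (-13) 2"
    using det[of 8 1 0 0 1 2 1] by simp
  have 2: "jprod 9 20 * jprod 8 20 = ?\<alpha> (-3) 0 * ?\<alpha> 1 0 - ?\<alpha> 17 3 * ?\<alpha> (-19) 5"
    using det[of 9 8 3 0 0 5 0] by simp
  have 3: "fps_X ^ 2 * (jprod 4 20 * jprod 3 20) = ?\<alpha> (-13) 2 * ?\<alpha> 1 0 - ?\<alpha> 7 0 * ?\<alpha> (-19) 5"
    using det[of 4 3 0 0 2 5 2] by simp
  have 4: "jprod 7 20 * jprod 4 20 = ?\<alpha> (-3) 0 * ?\<alpha> 9 0 - ?\<alpha> 17 3 * ?\<alpha> (-11) 1"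
    using det[of 13 4 3 0 0 1 0] jprod_reflect[of 13 20, where 'a = 'a] by simp
  have 5: "fps_X * (jprod 5 20 * jprod 4 20) = ?\<alpha> (-11) 1 * ?\<alpha> 1 0 - ?\<alpha> 9 0 * ?\<alpha> (-19) 5"
    using det[of 5 4 0 0 1 5 1] by simp
  have 6: "jprod 8 20 * jprod 5 20 = ?\<alpha> (-3) 0 * ?\<alpha> 7 0 - ?\<alpha> 17 3 * ?\<alpha> (-13) 2"
    using det[of 12 5 3 0 0 2 0] jprod_reflect[of 12 20, where 'a = 'a] by simp
  \<comment> \<open>The complementary pairs are 17, 9 with 7, 1; 17, 7 with 9, 1; and 17, 1 with 9,
    7. Every term contains a factor \<open>X\<close>, cancelled afterwards.\<close>
  have "(jprod 7 20 * jprod 4 20) * (fps_X ^ 2 * (jprod 4 20 * jprod 3 20))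
      - (jprod 8 20 * jprod 5 20) * (fps_X * (jprod 5 20 * jprod 4 20))
      + (jprod 9 20 * jprod 8 20) * (fps_X * (jprod 8 20 * jprod 1 20)) = (0 :: 'a fps)"
    unfolding 1 2 3 4 5 6 by (simp add: algebra_simps)
  then have "fps_X * (jprod 1 20 * jprod 9 20 * jprod 8 20 ^ 2 + fps_X * jprod 3 20 * jprod 7 20 * jprod 4 20 ^ 2
      - jprod 5 20 ^ 2 * jprod 4 20 * jprod 8 20) = (0 :: 'a fps)"
    by (simp add: algebra_simps power2_eq_square)
  then show ?thesis by simp
qed

section \<open>Dissections modulo 2 and 5, and the two factors of \<open>U^2 - V^2\<close>\<close>

lemma fps_qpoch_split_2:
  "a > 0 \<Longrightarrow> b > 0 \<Longrightarrow> fps_qpoch a b = fps_qpoch a (b * 2) * (fps_qpoch (a + b) (b * 2) :: 'a::field fps)"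
  using fps_qpoch_split[of a b 2, where 'a = 'a] by (simp add: numeral_2_eq_2)

lemma fps_qpoch_split_5:
  "a > 0 \<Longrightarrow> b > 0 \<Longrightarrow> fps_qpoch a b = fps_qpoch a (b * 5) * fps_qpoch (a + b) (b * 5)
    * fps_qpoch (a + b * 2) (b * 5) * fps_qpoch (a + b * 3) (b * 5) * (fps_qpoch (a + b * 4) (b * 5) :: 'a::field fps)"
  using fps_qpoch_split[of a b 5, where 'a = 'a] by (simp add: numeral_eq_Suc)

text \<open>Passage from base \<open>b\<close> to base \<open>2 * b\<close>: the two non-central
  factors split by parity of the index, and the four pieces regroup into reflected pairs.\<close>

lemma jprod_dissect_2:
  assumes "0 < a" "a < b"
  shows "jprod a b * fps_qpoch (2 * b) (2 * b) ^ 2 =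
    (fps_qpoch b b * (jprod a (2 * b) * jprod (b - a) (2 * b)) :: 'a::field fps)"
proof -
  have "2 * b - (b - a) = b + a" using assms by simp
  moreover have "b - a + b = 2 * b - a" using assms by simp
  ultimately show ?thesis
    using assms fps_qpoch_split_2[of a b, where 'a = 'a] fps_qpoch_split_2[of "b - a" b, where 'a = 'a]
    by (simp add: jprod_def power2_eq_square mult_ac add_ac)
qed

text \<open>The factor \<open>U + V\<close>: multiplied by \<open>(X^20; X^20)^2\<close>, the
  base-10 products become the pairs occurring in \<open>jprod_base_20\<close>.\<close>

lemma jprod_sum_identity:
  "jprod 1 10 * jprod 8 20 ^ 2 + fps_X * jprod 3 10 * jprod 4 20 ^ 2 =
    (jprod 5 10 * jprod 4 20 * jprod 8 20 :: 'a::field fps)"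
proof -
  let ?Q = "fps_qpoch 20 20 ^ 2 :: 'a fps" and ?P = "fps_qpoch 10 10 :: 'a fps"
  have 1: "jprod 1 10 * ?Q = ?P * (jprod 1 20 * jprod 9 20)"
    and 3: "jprod 3 10 * ?Q = ?P * (jprod 3 20 * jprod 7 20)"
    and 5: "jprod 5 10 * ?Q = ?P * (jprod 5 20 * jprod 5 20)"
    using jprod_dissect_2[of 1 10, where 'a = 'a] jprod_dissect_2[of 3 10, where 'a = 'a]
      jprod_dissect_2[of 5 10, where 'a = 'a] by simp_all
  have "?Q * (jprod 1 10 * jprod 8 20 ^ 2 + fps_X * jprod 3 10 * jprod 4 20 ^ 2) =
      (jprod 1 10 * ?Q) * jprod 8 20 ^ 2 + fps_X * (jprod 3 10 * ?Q) * jprod 4 20 ^ 2"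
    by (simp add: algebra_simps)
  also have "\<dots> = ?P * (jprod 1 20 * jprod 9 20 * jprod 8 20 ^ 2 + fps_X * jprod 3 20 * jprod 7 20 * jprod 4 20 ^ 2)"
    unfolding 1 3 by (simp add: algebra_simps)
  also have "\<dots> = (jprod 5 10 * ?Q) * jprod 4 20 * jprod 8 20"
    unfolding jprod_base_20 5 by (simp add: algebra_simps power2_eq_square)
  finally have "?Q * (jprod 1 10 * jprod 8 20 ^ 2 + fps_X * jprod 3 10 * jprod 4 20 ^ 2) =
      ?Q * (jprod 5 10 * jprod 4 20 * jprod 8 20)"
    by (simp add: mult_ac)
  then show ?thesis by simp
qed

text \<open>
  \<open>jprod 1 2\<close> squared is the sum of \<open>(-1)^(x + y) q^(x^2 + y^2)\<close> over the Gaussian integers \<open>x + iy\<close>, split by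
  residues modulo \<open>1 + 2i\<close>: the class of 0 gives \<open>jprod 5 10\<close> squared, and multiplication by \<open>i\<close>
  permutes the other four classes.
\<close>

lemma jprod_square_diff:
  "jprod 5 10 ^ 2 - jprod 1 2 ^ 2 = (4 * fps_X * jprod 1 10 * jprod 3 10 :: 'a::field fps)"
proof -
  let ?s = "(\<lambda>(x, y). parity_sign (x + y)) :: int \<times> int \<Rightarrow> 'a"
  let ?e = "\<lambda>(x, y). x^2 + y^2 :: int"
  \<comment> \<open>\<open>(x + i y) * (1 - 2i)\<close> has imaginary part \<open>y - 2 * x\<close>,
    and \<open>x + i y\<close> is divisible by \<open>1 + 2i\<close> exactly when 5 divides this
    number.\<close>
  let ?C = "\<lambda>c. {p \<in> UNIV. (snd p - 2 * fst p) mod 5 = c} :: (int \<times> int) set"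
  let ?S = "\<lambda>c. fps_isum (?C c) ?s ?e"
  \<comment> \<open>Multiplication by \<open>i\<close> doubles the label modulo 5, running through
    1, 2, 4, 3; it keeps the norm and the sign.\<close>
  have rotate: "?S c' = ?S c" if "c' = 2 * c mod 5" "0 \<le> c" "c < 5" for c c'
  proof (rule fps_isum_bij_witness[where g = "\<lambda>(x, y). (- y, x)" and h = "\<lambda>(x, y). (y, - x)"])
    fix i assume i: "i \<in> ?C c"
    obtain x y where xy: "i = (x, y)" by fastforce
    have "(x + 2 * y) mod 5 = (2 * (y - 2 * x) + 5 * x) mod 5"
      by (simp add: algebra_simps)
    also have "\<dots> = 2 * ((y - 2 * x) mod 5) mod 5"
      by (simp only: mod_mult_self2 mod_mult_right_eq)
    also have "\<dots> = c'"
      using i that by (simp add: xy)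
    finally have "(x + 2 * y) mod 5 = c'" .
    then show "(case i of (x, y) \<Rightarrow> (- y, x)) \<in> ?C c' \<and>
      (case case i of (x, y) \<Rightarrow> (- y, x) of (x, y) \<Rightarrow> (y, - x)) = i \<and>
      ?s (case i of (x, y) \<Rightarrow> (- y, x)) = ?s i \<and> ?e (case i of (x, y) \<Rightarrow> (- y, x)) = ?e i"
      by (auto simp: xy parity_sign_def)
  next
    fix j assume j: "j \<in> ?C c'"
    obtain x y where xy: "j = (x, y)" by fastforce
    \<comment> \<open>The inverse rotation multiplies the label by 3, the inverse of 2 modulo
      5.\<close>
    have "(- x - 2 * y) mod 5 = (3 * (y - 2 * x) + 5 * (x - y)) mod 5"
      by (simp add: algebra_simps)
    also have "\<dots> = 3 * ((y - 2 * x) mod 5) mod 5"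
      by (simp only: mod_mult_self2 mod_mult_right_eq)
    also have "\<dots> = 3 * (2 * c) mod 5"
      using j that by (simp add: xy mod_mult_right_eq)
    also have "3 * (2 * c) = c + 5 * c"
      by simp
    also have "(c + 5 * c) mod 5 = c"
      using that by (simp only: mod_mult_self2 mod_pos_pos_trivial)
    finally have "(- x - 2 * y) mod 5 = c" .
    then show "(case j of (x, y) \<Rightarrow> (y, - x)) \<in> ?C c \<and>
      (case case j of (x, y) \<Rightarrow> (y, - x) of (x, y) \<Rightarrow> (- y, x)) = j"
      by (auto simp: xy)
  qed
  have "jprod 1 2 ^ 2 = fps_isum UNIV ?s ?e"
    using jprod_mult(1)[of 1 1 1, where 'a = 'a] by (simp add: power2_eq_square)
  also have "\<dots> = (\<Sum>c\<in>{0, 1, 2, 3, 4}. ?S c)"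
  proof (rule fps_isum_split)
    show "exponents_ok UNIV ?e" using jprod_mult(2)[of 1 1 1] by simp
    show "(snd p - 2 * fst p) mod 5 \<in> {0, 1, 2, 3, 4}" for p :: "int \<times> int"
      using pos_mod_bound[of 5 "snd p - 2 * fst p"] pos_mod_sign[of 5 "snd p - 2 * fst p"] by auto
  qed simp
  also have "\<dots> = ?S 0 + 4 * ?S 2"
    using rotate[of 4 2] rotate[of 3 4] rotate[of 1 3] by simp
  also have "?S 0 = jprod 5 10 ^ 2"
  proof -
    have "jprod 5 10 ^ 2 = fps_isum UNIV ?s (\<lambda>(m, n). 5 * (m^2 + n^2))"
      using jprod_mult(1)[of 5 5 5, where 'a = 'a] by (simp add: power2_eq_square)
    moreover have "?S 0 = fps_isum UNIV ?s (\<lambda>(m, n). 5 * (m^2 + n^2))"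
    \<comment> \<open>The map is \<open>z -> (1 + 2i) * z\<close>, which multiplies the norm by 5
      and keeps the parity of \<open>x + y\<close>.\<close>
    proof (rule fps_isum_bij_witness[where g = "\<lambda>(m, n). (m - 2 * n, 2 * m + n)"
          and h = "\<lambda>(x, y). ((x + 2 * y) div 5, (y - 2 * x) div 5)"])
      fix i :: "int \<times> int"
      obtain m n where i: "i = (m, n)" by fastforce
      have "m - 2 * n + 2 * (2 * m + n) = 5 * m" "2 * m + n - 2 * (m - 2 * n) = 5 * n" by simp_all
      then show "(case i of (m, n) \<Rightarrow> (m - 2 * n, 2 * m + n)) \<in> ?C 0 \<and>
        (case case i of (m, n) \<Rightarrow> (m - 2 * n, 2 * m + n) of (x, y) \<Rightarrow> ((x + 2 * y) div 5, (y - 2 * x) div 5)) = i \<and>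
        ?s (case i of (m, n) \<Rightarrow> (m - 2 * n, 2 * m + n)) = ?s i \<and>
        ?e (case i of (m, n) \<Rightarrow> (m - 2 * n, 2 * m + n)) = (case i of (m, n) \<Rightarrow> 5 * (m^2 + n^2))"
        by (auto simp: i parity_sign_def power2_eq_square algebra_simps)
    next
      fix j assume "j \<in> ?C 0"
      obtain x y where xy: "j = (x, y)" by fastforce
      define k where "k = (y - 2 * x) div 5"
      have "y - 2 * x = 5 * k + 0"
        using \<open>j \<in> ?C 0\<close> div_mult_mod_eq[of "y - 2 * x" 5] by (simp add: xy k_def)
      then have y: "y = 2 * x + 5 * k" by simp
      have e: "x + 2 * y = 5 * (x + 2 * k)" "y - 2 * x = 5 * (k)"
        unfolding y by simp_all
      have "(x + 2 * y) div 5 = x + 2 * k" "(y - 2 * x) div 5 = k"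
        unfolding e by (rule nonzero_mult_div_cancel_left, simp)+
      then show "(case j of (x, y) \<Rightarrow> ((x + 2 * y) div 5, (y - 2 * x) div 5)) \<in> UNIV \<and>
        (case case j of (x, y) \<Rightarrow> ((x + 2 * y) div 5, (y - 2 * x) div 5) of (m, n) \<Rightarrow> (m - 2 * n, 2 * m + n)) = j"
        using y by (simp add: xy)
    qed
    ultimately show ?thesis by simp
  qed
  also have "?S 2 = - (fps_X * (jprod 1 10 * jprod 3 10))"
  proof -
    let ?f = "\<lambda>(m, n). 5 * (m^2 + n^2) + (1 - 5) * m + (3 - 5) * n :: int"
    have ok: "exponents_ok UNIV ?f" using jprod_mult(2)[of 1 5 3] by simp
    have "jprod 1 10 * jprod 3 10 = fps_isum UNIV ?s ?f"
      using jprod_mult(1)[of 1 5 3, where 'a = 'a] by simp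
    then have "- (fps_X * (jprod 1 10 * jprod 3 10)) = fps_isum UNIV (\<lambda>p. - ?s p) (\<lambda>p. ?f p + 1)"
      using fps_X_power_mult_isum[OF ok, of 1 ?s] by (simp add: fps_isum_uminus)
    moreover have "?S 2 = fps_isum UNIV (\<lambda>p. - ?s p) (\<lambda>p. ?f p + 1)"
    \<comment> \<open>The map is \<open>z -> (2 - i) * z - 1\<close>. Here \<open>2 - i\<close> is
      an associate of \<open>1 + 2i\<close>, and \<open>-1\<close> has label 2; the translation
      produces the linear terms of the exponent and flips the sign.\<close>
    proof (rule fps_isum_bij_witness[where g = "\<lambda>(m, n). (2 * m + n - 1, 2 * n - m)"
          and h = "\<lambda>(x, y). ((2 * x - y + 2) div 5, (x + 2 * y + 1) div 5)"])
      fix i :: "int \<times> int"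
      obtain m n where i: "i = (m, n)" by fastforce
      have "2 * (2 * m + n - 1) - (2 * n - m) + 2 = 5 * m" "2 * m + n - 1 + 2 * (2 * n - m) + 1 = 5 * n"
        by simp_all
      moreover have "(2 * n - m - 2 * (2 * m + n - 1)) mod 5 = 2" by presburger
      ultimately show "(case i of (m, n) \<Rightarrow> (2 * m + n - 1, 2 * n - m)) \<in> ?C 2 \<and>
        (case case i of (m, n) \<Rightarrow> (2 * m + n - 1, 2 * n - m) of (x, y) \<Rightarrow> ((2 * x - y + 2) div 5, (x + 2 * y + 1) div 5)) = i \<and>
        ?s (case i of (m, n) \<Rightarrow> (2 * m + n - 1, 2 * n - m)) = - ?s i \<and>
        ?e (case i of (m, n) \<Rightarrow> (2 * m + n - 1, 2 * n - m)) = ?f i + 1"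
        by (auto simp: i parity_sign_def power2_eq_square algebra_simps)
    next
      fix j assume "j \<in> ?C 2"
      obtain x y where xy: "j = (x, y)" by fastforce
      define k where "k = (y - 2 * x) div 5"
      have "y - 2 * x = 5 * k + 2"
        using \<open>j \<in> ?C 2\<close> div_mult_mod_eq[of "y - 2 * x" 5] by (simp add: xy k_def)
      then have y: "y = 2 * x + 5 * k + 2" by simp
      have e: "2 * x - y + 2 = 5 * (- k)" "x + 2 * y + 1 = 5 * (x + 1 + 2 * k)"
        unfolding y by simp_all
      have "(2 * x - y + 2) div 5 = - k" "(x + 2 * y + 1) div 5 = x + 1 + 2 * k"
        unfolding e by (rule nonzero_mult_div_cancel_left, simp)+
      then show "(case j of (x, y) \<Rightarrow> ((2 * x - y + 2) div 5, (x + 2 * y + 1) div 5)) \<in> UNIV \<and>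
        (case case j of (x, y) \<Rightarrow> ((2 * x - y + 2) div 5, (x + 2 * y + 1) div 5) of (m, n) \<Rightarrow> (2 * m + n - 1, 2 * n - m)) = j"
        using y by (simp add: xy)
    qed
    ultimately show ?thesis by simp
  qed
  finally show ?thesis by (simp add: algebra_simps)
qed

text \<open>In \<open>(U - V)^2 = (U + V)^2 - 4 * U * V\<close> the right side is known and equals
  the square of \<open>J 1 2 * W\<close>; the constant term 1 of \<open>U - V\<close> decides
  between the two roots.\<close>

lemma jprod_diff_identity:
  "jprod 1 10 * jprod 8 20 ^ 2 - fps_X * jprod 3 10 * jprod 4 20 ^ 2 =
    (jprod 1 2 * jprod 4 20 * jprod 8 20 :: 'a::field fps)"
proof -
  let ?U = "jprod 1 10 * jprod 8 20 ^ 2 :: 'a fps"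
  let ?V = "fps_X * jprod 3 10 * jprod 4 20 ^ 2 :: 'a fps"
  let ?W = "jprod 4 20 * jprod 8 20 :: 'a fps"
  have "(?U - ?V)^2 = (?U + ?V)^2 - (4 * fps_X * jprod 1 10 * jprod 3 10) * ?W^2"
    by (simp add: power2_eq_square algebra_simps)
  also have "\<dots> = (jprod 1 2 * ?W)^2"
    unfolding jprod_sum_identity jprod_square_diff[symmetric]
    by (simp add: power2_eq_square algebra_simps)
  finally have "?U - ?V = jprod 1 2 * ?W \<or> ?U - ?V = - (jprod 1 2 * ?W)"
    by (simp add: power2_eq_iff)
  moreover have "?U - ?V = jprod 1 2 * ?W" if *: "?U - ?V = - (jprod 1 2 * ?W)"
  proof -
    have "fps_nth (?U - ?V) 0 = 1"
      by (simp add: power2_eq_square)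
    \<comment> \<open>The wrong sign forces characteristic 2, where the two roots coincide.\<close>
    then have "(1 :: 'a) = - 1"
      unfolding * by simp
    then have "(- 1 :: 'a fps) = 1"
      by (metis fps_const_1_eq_1 fps_const_neg)
    then have "- (jprod 1 2 * ?W) = jprod 1 2 * ?W"
      by (metis mult_1 mult_minus1)
    with * show ?thesis by simp
  qed
  ultimately show ?thesis by (auto simp: mult.assoc)
qed

section \<open>The quotient of the k-functions\<close>

text \<open>Split \<open>E\<close> by parity and the odd factors modulo 10; one factor
  \<open>(X^5; X^10)\<close> completes the residues 1, 3, 7, 9 to all odd ones.\<close>

lemma jprod_eq_eta_quotient:
  "jprod 5 10 * jprod 1 2 * fps_qpoch 10 10 ^ 4 =
    (fps_qpoch 1 1 * fps_qpoch 5 5 ^ 3 * (jprod 1 10 * jprod 3 10) :: 'a::field fps)"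
proof -
  have "fps_qpoch 1 1 = fps_qpoch 1 2 * (fps_qpoch 2 2 :: 'a fps)"
    and "fps_qpoch 5 5 = fps_qpoch 5 10 * (fps_qpoch 10 10 :: 'a fps)"
    using fps_qpoch_split_2[of 1 1, where 'a = 'a] fps_qpoch_split_2[of 5 5, where 'a = 'a]
    by (simp_all add: numeral_2_eq_2[symmetric] del: One_nat_def)
  moreover have "fps_qpoch 1 2 = fps_qpoch 1 10 * fps_qpoch 3 10 * fps_qpoch 5 10 * fps_qpoch 7 10
      * (fps_qpoch 9 10 :: 'a fps)"
    using fps_qpoch_split_5[of 1 2, where 'a = 'a] by (simp del: One_nat_def)
  moreover have "jprod 1 2 = fps_qpoch 2 2 * (fps_qpoch 1 2 :: 'a fps)^2"
    by (simp add: jprod_def power2_eq_square)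
  ultimately show ?thesis
    by (simp add: jprod_def power_numeral_reduce algebra_simps del: One_nat_def)
qed

abbreviation fls_qpoch :: "nat \<Rightarrow> nat \<Rightarrow> 'a::field fls" where
  "fls_qpoch a b \<equiv> fps_to_fls (fps_qpoch a b)"

lemma Efun_fls_X_power: "d > 0 \<Longrightarrow> Efun (fls_X ^ d) = (fls_qpoch d d :: 'a::field fls)"
  by (simp add: Efun_def qpoch_fls_X_power)

lemma Rfun_fls_X_power:
  assumes "d > 0"
  shows "Rfun (fls_X ^ d) = fls_qpoch d (d * 5) * fls_qpoch (d * 4) (d * 5) /
    (fls_qpoch (d * 2) (d * 5) * fls_qpoch (d * 3) (d * 5) :: 'a::field fls)"
  using assms by (simp add: Rfun_def qpochs_def qpoch_fls_X_power flip: power_mult)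

text \<open>Over base 10 the factors of \<open>R(q)\<close> at the residues 2, 4, 6, 8 cancel
  against \<open>R(q^2)\<close>, leaving 1, 9 over 3, 7.\<close>

lemma Rfun_1_mult_Rfun_2:
  "Rfun fls_X * Rfun (fls_X ^ 2) = (fps_to_fls (jprod 1 10) / fps_to_fls (jprod 3 10) :: 'a::field fls)"
proof -
  have "fls_qpoch 1 5 = fls_qpoch 1 10 * (fls_qpoch 6 10 :: 'a fls)"
    "fls_qpoch 2 5 = fls_qpoch 2 10 * (fls_qpoch 7 10 :: 'a fls)"
    "fls_qpoch 3 5 = fls_qpoch 3 10 * (fls_qpoch 8 10 :: 'a fls)"
    "fls_qpoch 4 5 = fls_qpoch 4 10 * (fls_qpoch 9 10 :: 'a fls)"
    using fps_qpoch_split_2[of 1 5, where 'a = 'a] fps_qpoch_split_2[of 2 5, where 'a = 'a]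
      fps_qpoch_split_2[of 3 5, where 'a = 'a] fps_qpoch_split_2[of 4 5, where 'a = 'a]
    by (simp_all add: fls_times_fps_to_fls del: One_nat_def)
  moreover have "Rfun fls_X = fls_qpoch 1 5 * fls_qpoch 4 5 / (fls_qpoch 2 5 * fls_qpoch 3 5 :: 'a fls)"
    using Rfun_fls_X_power[of 1, where 'a = 'a] by simp
  moreover have "Rfun (fls_X ^ 2) = fls_qpoch 2 10 * fls_qpoch 8 10 / (fls_qpoch 4 10 * fls_qpoch 6 10 :: 'a fls)"
    using Rfun_fls_X_power[of 2, where 'a = 'a] by simp
  ultimately show ?thesis
    by (simp only:) (simp add: jprod_def fls_times_fps_to_fls field_simps del: One_nat_def)
qed

lemma Rfun_4: "Rfun (fls_X ^ 4) = (fps_to_fls (jprod 4 20) / fps_to_fls (jprod 8 20) :: 'a::field fls)"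
  using Rfun_fls_X_power[of 4, where 'a = 'a]
  by (simp add: jprod_def fls_times_fps_to_fls)

lemma Rfun_nonzero: "d > 0 \<Longrightarrow> Rfun (fls_X ^ d) \<noteq> (0 :: 'a::field fls)"
  by (simp add: Rfun_fls_X_power)

text \<open>One \<open>q\<close> and one \<open>R(q^2)\<close> cancel, leaving
  \<open>R(q) * R(q^2) / (q * R(q^4)^2)\<close>, to which the two evaluations above apply.\<close>

lemma kfun_quotient:
  "kfun fls_X / kfun (fls_X ^ 2) =
    (fps_to_fls (jprod 1 10 * jprod 8 20 ^ 2) / fps_to_fls (fps_X * jprod 3 10 * jprod 4 20 ^ 2) :: 'a::field fls)"
proof -
  have X4: "(fls_X ^ 2) ^ 2 = (fls_X ^ 4 :: 'a fls)"
    by (simp flip: power_mult)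
  have "(x * r1 * r2^2) / (x^2 * r2 * r4^2) = r1 * r2 / (x * r4^2)"
    if "r2 \<noteq> 0" "x \<noteq> 0" for x r1 r2 r4 :: "'a fls"
    using that by (simp add: divide_simps power2_eq_square)
  then have "kfun fls_X / kfun (fls_X ^ 2) =
      Rfun fls_X * Rfun (fls_X ^ 2) / (fls_X * (Rfun (fls_X ^ 4) :: 'a fls)^2)"
    unfolding kfun_def X4 by (simp add: Rfun_nonzero)
  also have "\<dots> = fps_to_fls (jprod 1 10 * jprod 8 20 ^ 2) / fps_to_fls (fps_X * jprod 3 10 * jprod 4 20 ^ 2)"
    unfolding Rfun_1_mult_Rfun_2 Rfun_4
    by (simp add: fls_times_fps_to_fls fps_to_fls_power power_divide field_simps)
  finally show ?thesis .
qed

theorem theorem3p2: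
  "kfun fls_X / kfun (fls_X ^ 2) - kfun (fls_X ^ 2) / kfun fls_X =
     Efun fls_X * Efun (fls_X ^ 5) ^ 3 / ((fls_X :: 'a::field_char_0 fls) * Efun (fls_X ^ 10) ^ 4)"
proof -
  let ?U = "jprod 1 10 * jprod 8 20 ^ 2 :: 'a fps"
  let ?V = "fps_X * jprod 3 10 * jprod 4 20 ^ 2 :: 'a fps"
  let ?W = "jprod 4 20 * jprod 8 20 :: 'a fps"
  \<comment> \<open>The claim cross-multiplied through
    \<open>u / v - v / u = (u^2 - v^2) / (u * v)\<close>, still in power series, where the
    factorisations hold.\<close>
  have "(?U^2 - ?V^2) * (fps_X * fps_qpoch 10 10 ^ 4) =
      (?U + ?V) * (?U - ?V) * (fps_X * fps_qpoch 10 10 ^ 4)"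
    by (simp add: power2_eq_square algebra_simps)
  also have "\<dots> = (jprod 5 10 * jprod 1 2 * fps_qpoch 10 10 ^ 4) * (fps_X * ?W^2)"
    unfolding jprod_sum_identity jprod_diff_identity by (simp add: power2_eq_square mult_ac)
  \<comment> \<open>Here \<open>U * V = X * J 1 10 * J 3 10 * W^2\<close> collects the remaining
    factors.\<close>
  also have "\<dots> = (fps_qpoch 1 1 * fps_qpoch 5 5 ^ 3) * (?U * ?V)"
    unfolding jprod_eq_eta_quotient by (simp add: power2_eq_square mult_ac)
  finally have main: "((fps_to_fls ?U)^2 - (fps_to_fls ?V)^2) * (fls_X * fls_qpoch 10 10 ^ 4) =
      (fls_qpoch 1 1 * fls_qpoch 5 5 ^ 3) * (fps_to_fls ?U * fps_to_fls ?V)"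
    by (simp only: fps_X_to_fls[symmetric] fps_to_fls_power[symmetric] fls_times_fps_to_fls[symmetric]
        fps_to_fls_minus[symmetric])
  have nz: "fps_to_fls ?U \<noteq> 0" "fps_to_fls ?V \<noteq> 0" "fls_X * fls_qpoch 10 10 ^ 4 \<noteq> (0 :: 'a fls)"
    by simp_all
  have diff_quot: "u / v - v / u = (u^2 - v^2) / (u * v)" if "u \<noteq> 0" "v \<noteq> 0" for u v :: "'a fls"
    using that by (simp add: field_simps power2_eq_square)
  have "kfun (fls_X ^ 2) / kfun fls_X = fps_to_fls ?V / fps_to_fls ?U"
    using arg_cong[OF kfun_quotient[where 'a = 'a], of inverse] by simp
  then have "kfun fls_X / kfun (fls_X ^ 2) - kfun (fls_X ^ 2) / kfun fls_X =
      fps_to_fls ?U / fps_to_fls ?V - fps_to_fls ?V / fps_to_fls ?U"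
    by (simp only: kfun_quotient)
  also have "\<dots> = ((fps_to_fls ?U)^2 - (fps_to_fls ?V)^2) / (fps_to_fls ?U * fps_to_fls ?V)"
    by (rule diff_quot[OF nz(1,2)])
  also have "\<dots> = fls_qpoch 1 1 * fls_qpoch 5 5 ^ 3 / (fls_X * fls_qpoch 10 10 ^ 4)"
    using nz main by (simp only: frac_eq_eq mult_eq_0_iff not_False_eq_True simp_thms)
  finally show ?thesis
    using Efun_fls_X_power[of 1, where 'a = 'a] by (simp add: Efun_fls_X_power)
qed

end
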